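(* Let $(H^+,\oplus)$ be a gyrogroup, let $H^-$ be a set disjoint from $H^+$, and let $\varphi:H^+\to H^-$ be a bijection. Let $G=H^+\cup H^-$ with the binary operation $\otimes$ defined in the context. Then $(G,\otimes)$ is a gyrogroup, and its gyrator $\mathrm{gyr}_G:G\times G\to \mathrm{Aut}(G,\otimes)$ is given, for all $a^{\epsilon},b^{\delta},t^{\gamma}\in G$ (with $a^+,b^+,t^+\in H^+$ and $\epsilon,\delta,\gamma\in\{+,-\}$), by $$\mathrm{gyr}_G[a^{\epsilon},b^{\delta}](t^{\gamma})=\begin{cases}\mathrm{gyr}_{H^+}[a^+,b^+](t^+) & \text{if }\gamma=+,\\ \bigl(\mathrm{gyr}_{H^+}[a^+,b^+](t^+)\bigr)^- & \text{if }\gamma=-.\end{cases}$$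
   Context: A groupoid $(G,\oplus)$ (a set with a binary operation) is a gyrogroup if: (i) there is an element $0\in G$ with $0\oplus x=x$ for all $x\in G$; (ii) for each $a\in G$ there is $b\in G$ with $b\oplus a=0$; (iii) there is a function $\mathrm{gyr}:G\times G\to \mathrm{Aut}(G,\oplus)$ (the gyrator), written $\mathrm{gyr}[a,b]c=\mathrm{gyr}(a,b)(c)$, such that $a\oplus(b\oplus c)=(a\oplus b)\oplus \mathrm{gyr}[a,b]c$ for all $a,b,c\in G$; (iv) $\mathrm{gyr}[a,b]=\mathrm{gyr}[a\oplus b,b]$ for all $a,b\in G$. Here $\mathrm{Aut}(G,\oplus)$ is the set of bijections of $G$ preserving the operation. Construction. An arbitrary element of $H^+$ is denoted $x^+$, and one writes $x^-=\varphi(x^+)$; more generally, for $h\in H^+$, $(h)^-$ means $\varphi(h)$. Thus every element of $G=H^+\cup H^-$ is uniquely of the form $x^{\epsilon}$ with $x^+\in H^+$ and $\epsilon\in\{+,-\}$. The operation on $G$ is $$a^{\epsilon}\otimes b^{\delta}=\begin{cases}a^+\oplus b^+ & (\epsilon,\delta)=(+,+)\text{ or }(-,-),\\ (a^+\oplus b^+)^- & (\epsilon,\delta)=(+,-)\text{ or }(-,+).\end{cases}$$ *)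

theory Defs
  imports Main
begin

definition groupoid_aut :: "'a set \<Rightarrow> ('a \<Rightarrow> 'a \<Rightarrow> 'a) \<Rightarrow> ('a \<Rightarrow> 'a) set" where
  "groupoid_aut G f =
     {h. bij_betw h G G \<and> (\<forall>x\<in>G. \<forall>y\<in>G. h (f x y) = f (h x) (h y))}"

text \<open>
  Functions on the carrier are represented by total functions of which only the values on the
  carrier matter; hence the equality of functions in the left loop property is pointwise on
  the carrier.
\<close>

definition is_gyrator ::
    "'a set \<Rightarrow> ('a \<Rightarrow> 'a \<Rightarrow> 'a) \<Rightarrow> ('a \<Rightarrow> 'a \<Rightarrow> 'a \<Rightarrow> 'a) \<Rightarrow> bool" where
  "is_gyrator G f gyr \<longleftrightarrow>
     (\<forall>a\<in>G. \<forall>b\<in>G. gyr a b \<in> groupoid_aut G f) \<and>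
     (\<forall>a\<in>G. \<forall>b\<in>G. \<forall>c\<in>G. f a (f b c) = f (f a b) (gyr a b c)) \<and>
     (\<forall>a\<in>G. \<forall>b\<in>G. \<forall>c\<in>G. gyr a b c = gyr (f a b) b c)"

definition gyrogroup :: "'a set \<Rightarrow> ('a \<Rightarrow> 'a \<Rightarrow> 'a) \<Rightarrow> bool" where
  "gyrogroup G f \<longleftrightarrow>
     (\<forall>x\<in>G. \<forall>y\<in>G. f x y \<in> G) \<and>
     (\<exists>e\<in>G. (\<forall>x\<in>G. f e x = x) \<and> (\<forall>a\<in>G. \<exists>b\<in>G. f b a = e)) \<and>
     (\<exists>gyr. is_gyrator G f gyr)"

datatype sign = Plus | Minus

text \<open>\<open>signed \<phi> \<epsilon> h\<close> is the element \<open>h\<^sup>\<epsilon>\<close>: \<open>h\<close> itself or its copy \<open>h\<^sup>- = \<phi> h\<close>.\<close>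

fun signed :: "('a \<Rightarrow> 'a) \<Rightarrow> sign \<Rightarrow> 'a \<Rightarrow> 'a" where
  "signed \<phi> Plus h = h"
| "signed \<phi> Minus h = \<phi> h"

text \<open>The element \<open>x\<^sup>+\<close> of \<open>Hp\<close> underlying an element of \<open>Hp \<union> \<phi> ` Hp\<close>.\<close>

definition plus_part :: "'a set \<Rightarrow> ('a \<Rightarrow> 'a) \<Rightarrow> 'a \<Rightarrow> 'a" where
  "plus_part Hp \<phi> x = (if x \<in> Hp then x else inv_into Hp \<phi> x)"

definition double_op ::
    "'a set \<Rightarrow> ('a \<Rightarrow> 'a \<Rightarrow> 'a) \<Rightarrow> ('a \<Rightarrow> 'a) \<Rightarrow> 'a \<Rightarrow> 'a \<Rightarrow> 'a" where
  "double_op Hp f \<phi> x y =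
     (let h = f (plus_part Hp \<phi> x) (plus_part Hp \<phi> y)
      in if x \<in> Hp \<longleftrightarrow> y \<in> Hp then h else \<phi> h)"

lemma signed_unique_representation:
  assumes "Hp \<inter> Hm = {}" and "bij_betw \<phi> Hp Hm" and "x \<in> Hp \<union> Hm"
  shows "\<exists>!(\<epsilon>, h). h \<in> Hp \<and> x = signed \<phi> \<epsilon> h"
proof -
  have mem: "\<phi> h \<in> Hm" if "h \<in> Hp" for h
    using assms(2) that by (auto simp: bij_betw_def)
  have inj: "h = k" if "h \<in> Hp" "k \<in> Hp" "\<phi> h = \<phi> k" for h k
    using assms(2) that by (auto simp: bij_betw_def inj_on_def)
  have ex: "\<exists>\<epsilon> h. h \<in> Hp \<and> x = signed \<phi> \<epsilon> h"
    using assms(2,3) by (metis UnE bij_betw_def imageE signed.simps)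
  have uniq: "\<epsilon> = \<delta> \<and> h = k"
    if "h \<in> Hp" "k \<in> Hp" "signed \<phi> \<epsilon> h = signed \<phi> \<delta> k" for \<epsilon> \<delta> h k
    using that mem[of h] mem[of k] inj[of h k] assms(1) by (cases \<epsilon>; cases \<delta>) auto
  from ex obtain \<epsilon> h where "h \<in> Hp" "x = signed \<phi> \<epsilon> h" by blast
  then show ?thesis using uniq by (intro ex1I[of _ "(\<epsilon>, h)"]) auto
qed

lemma double_op_cases:
  assumes "Hp \<inter> Hm = {}" and "bij_betw \<phi> Hp Hm" and "a \<in> Hp" and "b \<in> Hp"
  shows "double_op Hp f \<phi> a b = f a b"
    and "double_op Hp f \<phi> (\<phi> a) (\<phi> b) = f a b"
    and "double_op Hp f \<phi> a (\<phi> b) = \<phi> (f a b)"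
    and "double_op Hp f \<phi> (\<phi> a) b = \<phi> (f a b)"
proof -
  have "\<phi> a \<notin> Hp" "\<phi> b \<notin> Hp" and "inj_on \<phi> Hp"
    using assms by (auto simp: bij_betw_def)
  then show "double_op Hp f \<phi> a b = f a b"
    and "double_op Hp f \<phi> (\<phi> a) (\<phi> b) = f a b"
    and "double_op Hp f \<phi> a (\<phi> b) = \<phi> (f a b)"
    and "double_op Hp f \<phi> (\<phi> a) b = \<phi> (f a b)"
    using assms(3,4) by (simp_all add: double_op_def plus_part_def)
qed

end

theory Submission
  imports Defs
begin

text \<open>
  The sign of a product in the doubled groupoid is the product of the signs, so the sign splits off
  and each axiom, with the proposed gyrator, reduces to the same axiom in \<open>Hp\<close>. Conversely, a
  gyrogroup is left cancellative because \<open>b \<oplus> (a \<oplus> x) = gyr[b,a]x\<close> for a left inverse \<open>b\<close> of \<open>a\<close>;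
  hence the gyroassociative law determines the gyrator.
\<close>

lemma gyrogroup_closed:
  assumes "gyrogroup G f" "x \<in> G" "y \<in> G"
  shows "f x y \<in> G"
  using assms by (simp add: gyrogroup_def)

lemma gyrator_bij:
  assumes "is_gyrator G f gyr" "a \<in> G" "b \<in> G"
  shows "bij_betw (gyr a b) G G"
  using assms by (simp add: is_gyrator_def groupoid_aut_def)

lemma gyrator_hom:
  assumes "is_gyrator G f gyr" "a \<in> G" "b \<in> G" "x \<in> G" "y \<in> G"
  shows "gyr a b (f x y) = f (gyr a b x) (gyr a b y)"
  using assms by (simp add: is_gyrator_def groupoid_aut_def)

lemma gyrator_closed:
  assumes "is_gyrator G f gyr" "a \<in> G" "b \<in> G" "c \<in> G"
  shows "gyr a b c \<in> G"
  using gyrator_bij[OF assms(1-3)] assms(4) by (rule bij_betw_apply)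

lemma gyrator_assoc:
  assumes "is_gyrator G f gyr" "a \<in> G" "b \<in> G" "c \<in> G"
  shows "f a (f b c) = f (f a b) (gyr a b c)"
  using assms by (simp add: is_gyrator_def)

lemma gyrator_loop:
  assumes "is_gyrator G f gyr" "a \<in> G" "b \<in> G" "c \<in> G"
  shows "gyr a b c = gyr (f a b) b c"
  using assms unfolding is_gyrator_def by blast

lemma gyrogroup_left_cancel:
  assumes "gyrogroup G f" "a \<in> G" "x \<in> G" "y \<in> G" "f a x = f a y"
  shows "x = y"
proof -
  from assms(1) obtain e gyr
    where e: "\<And>x. x \<in> G \<Longrightarrow> f e x = x" "\<And>a. a \<in> G \<Longrightarrow> \<exists>b\<in>G. f b a = e"
      and gyr: "is_gyrator G f gyr"
    unfolding gyrogroup_def by blast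
  obtain b where b: "b \<in> G" "f b a = e"
    using e(2) assms(2) by blast
  \<comment> \<open>Gyroassociativity turns the left side into \<open>f (f b a) (gyr b a z)\<close>,
    and the left identity \<open>f b a = e\<close> disappears because \<open>gyr b a z\<close> lies
    in \<open>G\<close>. Injectivity of \<open>gyr b a\<close> then cancels
    \<open>a\<close>.\<close>
  have "f b (f a z) = gyr b a z" if "z \<in> G" for z
    using gyrator_assoc[OF gyr b(1) assms(2) that] e(1) b
      gyrator_closed[OF gyr b(1) assms(2) that] by simp
  then have "gyr b a x = gyr b a y"
    using assms(3-5) by metis
  then show ?thesis
    using gyrator_bij[OF gyr b(1) assms(2)] assms(3,4) by (auto simp: bij_betw_def inj_on_def)
qed

text \<open>Both values solve \<open>f (f a b) X = f a (f b c)\<close> for \<open>X\<close> in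
  \<open>G\<close>, and left cancellation of \<open>f a b\<close> allows one solution.\<close>

lemma gyrator_unique:
  assumes "gyrogroup G f" "is_gyrator G f g" "is_gyrator G f g'" "a \<in> G" "b \<in> G" "c \<in> G"
  shows "g a b c = g' a b c"
proof (rule gyrogroup_left_cancel[OF assms(1)])
  show "f a b \<in> G"
    using assms by (simp add: gyrogroup_closed)
  show "f (f a b) (g a b c) = f (f a b) (g' a b c)"
    using gyrator_assoc[OF assms(2,4-6)] gyrator_assoc[OF assms(3-6)] by simp
qed (use assms gyrator_closed in metis)+

fun sign_mult :: "sign \<Rightarrow> sign \<Rightarrow> sign" where
  "sign_mult \<epsilon> \<delta> = (if \<epsilon> = \<delta> then Plus else Minus)"

text \<open>\<open>sign_mult\<close> is the group of order two with identity \<open>Plus\<close>.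
  Its associativity gives both sides of the gyroassociative law the same sign.\<close>

lemma sign_mult_assoc:
  "sign_mult \<epsilon> (sign_mult \<delta> \<gamma>) = sign_mult (sign_mult \<epsilon> \<delta>) \<gamma>"
  by (cases \<epsilon>; cases \<delta>; cases \<gamma>) auto

context
  fixes Hp Hm :: "'a set" and \<phi> :: "'a \<Rightarrow> 'a"
  assumes disj: "Hp \<inter> Hm = {}" and bij: "bij_betw \<phi> Hp Hm"
begin

lemma signed_closed: "h \<in> Hp \<Longrightarrow> signed \<phi> \<epsilon> h \<in> Hp \<union> Hm"
  using bij by (cases \<epsilon>) (auto simp: bij_betw_def)

lemma signed_obtain:
  assumes "x \<in> Hp \<union> Hm"
  obtains \<epsilon> h where "h \<in> Hp" "x = signed \<phi> \<epsilon> h"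
  using signed_unique_representation[OF disj bij assms] by blast

lemma signed_inject:
  assumes "h \<in> Hp" "k \<in> Hp"
  shows "signed \<phi> \<epsilon> h = signed \<phi> \<delta> k \<longleftrightarrow> \<epsilon> = \<delta> \<and> h = k"
  using signed_unique_representation[OF disj bij signed_closed[OF assms(1), of \<epsilon>]] assms by auto

text \<open>Packs the four cases of the operation into one equation, so that signs and underlying
  elements can be treated separately from here on.\<close>

lemma double_op_signed:
  assumes "a \<in> Hp" "b \<in> Hp"
  shows "double_op Hp f \<phi> (signed \<phi> \<epsilon> a) (signed \<phi> \<delta> b) = signed \<phi> (sign_mult \<epsilon> \<delta>) (f a b)"
  using double_op_cases[OF disj bij assms] by (cases \<epsilon>; cases \<delta>) simp_all

text \<open>\<open>g\<close> ignores the signs of its first two arguments and preserves that of the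
  third, so \<open>g x y\<close> acts as \<open>gyr a b\<close> on each of the two copies. Since
  \<open>g\<close> is given only by its values on signed elements, the lemma serves both to
  construct a gyrator and to recognize one.\<close>

lemma is_gyrator_double:
  assumes H: "gyrogroup Hp f" and gyr: "is_gyrator Hp f gyr"
    and g: "\<And>a b t \<epsilon> \<delta> \<gamma>. a \<in> Hp \<Longrightarrow> b \<in> Hp \<Longrightarrow> t \<in> Hp \<Longrightarrow>
      g (signed \<phi> \<epsilon> a) (signed \<phi> \<delta> b) (signed \<phi> \<gamma> t) = signed \<phi> \<gamma> (gyr a b t)"
  shows "is_gyrator (Hp \<union> Hm) (double_op Hp f \<phi>) g"
  unfolding is_gyrator_def
proof (intro conjI ballI)
  note [simp] = g double_op_signed gyrogroup_closed[OF H] gyrator_closed[OF gyr] signed_closed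
    signed_inject
  fix x y assume "x \<in> Hp \<union> Hm" "y \<in> Hp \<union> Hm"
  then obtain \<epsilon> a \<delta> b where ab [simp]: "a \<in> Hp" "b \<in> Hp"
    and x: "x = signed \<phi> \<epsilon> a" and y: "y = signed \<phi> \<delta> b"
    by (metis signed_obtain)
  have bij_ab: "bij_betw (gyr a b) Hp Hp"
    using gyr ab by (rule gyrator_bij)
  have "inj_on (g x y) (Hp \<union> Hm)"
  proof (rule inj_onI)
    fix u v assume "u \<in> Hp \<union> Hm" "v \<in> Hp \<union> Hm" and eq: "g x y u = g x y v"
    then obtain \<gamma> s \<eta> t where st [simp]: "s \<in> Hp" "t \<in> Hp"
      and uv: "u = signed \<phi> \<gamma> s" "v = signed \<phi> \<eta> t"
      by (metis signed_obtain)
    from eq have "\<gamma> = \<eta>" "gyr a b s = gyr a b t"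
      by (simp_all add: x y uv)
    then show "u = v"
      using inj_onD[OF bij_betw_imp_inj_on[OF bij_ab] _ st] by (simp add: uv)
  qed
  moreover have "g x y u \<in> Hp \<union> Hm" if u: "u \<in> Hp \<union> Hm" for u
  proof -
    from u obtain \<gamma> s where "s \<in> Hp" "u = signed \<phi> \<gamma> s"
      by (rule signed_obtain)
    then show ?thesis
      using signed_closed[of "gyr a b s" \<gamma>] by (simp add: x y)
  qed
  moreover have "u \<in> g x y ` (Hp \<union> Hm)" if u: "u \<in> Hp \<union> Hm" for u
  proof -
    from u obtain \<gamma> s where s: "s \<in> Hp" "u = signed \<phi> \<gamma> s"
      by (rule signed_obtain)
    \<comment> \<open>As \<open>g x y\<close> preserves signs, a preimage of \<open>s\<close> under
      \<open>gyr a b\<close>, given the sign of \<open>u\<close>, is a preimage of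
      \<open>u\<close>.\<close>
    then obtain t where t: "t \<in> Hp" "s = gyr a b t"
      using bij_ab by (auto simp: bij_betw_def)
    then have "u = g x y (signed \<phi> \<gamma> t)"
      by (simp add: x y s)
    then show ?thesis
      using signed_closed[OF t(1)] by (rule image_eqI)
  qed
  ultimately have "bij_betw (g x y) (Hp \<union> Hm) (Hp \<union> Hm)"
    by (auto simp: bij_betw_def)
  moreover have "g x y (double_op Hp f \<phi> u v) = double_op Hp f \<phi> (g x y u) (g x y v)"
    if "u \<in> Hp \<union> Hm" "v \<in> Hp \<union> Hm" for u v
  proof -
    from that obtain \<gamma> s \<eta> t where "s \<in> Hp" "t \<in> Hp" "u = signed \<phi> \<gamma> s" "v = signed \<phi> \<eta> t"
      by (metis signed_obtain)
    then show ?thesis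
      by (simp add: x y gyrator_hom[OF gyr] del: sign_mult.simps)
  qed
  ultimately show "g x y \<in> groupoid_aut (Hp \<union> Hm) (double_op Hp f \<phi>)"
    by (simp add: groupoid_aut_def)
  fix z assume "z \<in> Hp \<union> Hm"
  then obtain \<gamma> c where c [simp]: "c \<in> Hp" and z: "z = signed \<phi> \<gamma> c"
    by (rule signed_obtain)
  show "double_op Hp f \<phi> x (double_op Hp f \<phi> y z) =
      double_op Hp f \<phi> (double_op Hp f \<phi> x y) (g x y z)"
    \<comment> \<open>The underlying elements agree by \<open>gyrator_assoc\<close>, the signs by
      \<open>sign_mult_assoc\<close>; the latter can rewrite only while \<open>sign_mult\<close>
      stays folded.\<close>
    by (simp add: x y z gyrator_assoc[OF gyr] sign_mult_assoc del: sign_mult.simps)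
  \<comment> \<open>The product has underlying element \<open>f a b\<close>, and its sign does not
    affect \<open>g\<close>.\<close>
  show "g x y z = g (double_op Hp f \<phi> x y) y z"
    using gyrator_loop[OF gyr ab c] by (simp add: x y z del: sign_mult.simps)
qed

lemma plus_part_signed:
  assumes "h \<in> Hp"
  shows "plus_part Hp \<phi> (signed \<phi> \<epsilon> h) = h"
  using assms disj bij by (cases \<epsilon>) (auto simp: plus_part_def bij_betw_def)

text \<open>The prescription is consistent because an element of the union determines both its sign
  and its underlying element.\<close>

lemma double_gyrator_exists:
  obtains g where "\<And>a b t \<epsilon> \<delta> \<gamma>. a \<in> Hp \<Longrightarrow> b \<in> Hp \<Longrightarrow> t \<in> Hp \<Longrightarrow>
    g (signed \<phi> \<epsilon> a) (signed \<phi> \<delta> b) (signed \<phi> \<gamma> t) = signed \<phi> \<gamma> (gyr a b t)"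
proof
  let ?p = "plus_part Hp \<phi>"
  \<comment> \<open>The sign of \<open>z\<close> is read off from membership in \<open>Hp\<close>,
    as \<open>\<phi>\<close> maps into the disjoint set \<open>Hm\<close>.\<close>
  let ?g = "\<lambda>x y z. signed \<phi> (if z \<in> Hp then Plus else Minus) (gyr (?p x) (?p y) (?p z))"
  fix a b t \<epsilon> \<delta> \<gamma>
  assume abt: "a \<in> Hp" "b \<in> Hp" "t \<in> Hp"
  then have "(if signed \<phi> \<gamma> t \<in> Hp then Plus else Minus) = \<gamma>"
    using disj bij by (cases \<gamma>) (auto simp: bij_betw_def)
  with abt show "?g (signed \<phi> \<epsilon> a) (signed \<phi> \<delta> b) (signed \<phi> \<gamma> t) = signed \<phi> \<gamma> (gyr a b t)"
    by (simp only: plus_part_signed)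
qed

lemma gyrogroup_double:
  assumes H: "gyrogroup Hp f"
  shows "gyrogroup (Hp \<union> Hm) (double_op Hp f \<phi>)"
proof -
  from H obtain e gyr where e: "e \<in> Hp" "\<And>x. x \<in> Hp \<Longrightarrow> f e x = x"
      "\<And>a. a \<in> Hp \<Longrightarrow> \<exists>b\<in>Hp. f b a = e"
    and gyr: "is_gyrator Hp f gyr"
    unfolding gyrogroup_def by blast
  have closed: "double_op Hp f \<phi> x y \<in> Hp \<union> Hm" if "x \<in> Hp \<union> Hm" "y \<in> Hp \<union> Hm" for x y
  proof -
    from that obtain \<epsilon> a \<delta> b where "a \<in> Hp" "b \<in> Hp" "x = signed \<phi> \<epsilon> a" "y = signed \<phi> \<delta> b"
      by (metis signed_obtain)
    then show ?thesis
      using signed_closed[OF gyrogroup_closed[OF H]] by (simp only: double_op_signed)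
  qed
  have unit: "double_op Hp f \<phi> e x = x" if x: "x \<in> Hp \<union> Hm" for x
  proof -
    from x obtain \<epsilon> a where "a \<in> Hp" "x = signed \<phi> \<epsilon> a"
      by (rule signed_obtain)
    then show ?thesis
      using double_op_cases(1,3)[OF disj bij e(1)] e(2) by (cases \<epsilon>) auto
  qed
  have inverse: "\<exists>y\<in>Hp \<union> Hm. double_op Hp f \<phi> y x = e" if x: "x \<in> Hp \<union> Hm" for x
  proof -
    from x obtain \<epsilon> a where a: "a \<in> Hp" "x = signed \<phi> \<epsilon> a"
      by (rule signed_obtain)
    obtain b where b: "b \<in> Hp" "f b a = e"
      using e(3) a(1) by blast
    \<comment> \<open>The left inverse takes the sign of \<open>x\<close>: equal signs multiply to
      \<open>Plus\<close>, which gives \<open>e\<close> and not \<open>\<phi> e\<close>.\<close>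
    then have "double_op Hp f \<phi> (signed \<phi> \<epsilon> b) x = e"
      using a by (simp add: double_op_signed)
    then show ?thesis
      using signed_closed[OF b(1)] by blast
  qed
  obtain g where "\<And>a b t \<epsilon> \<delta> \<gamma>. a \<in> Hp \<Longrightarrow> b \<in> Hp \<Longrightarrow> t \<in> Hp \<Longrightarrow>
      g (signed \<phi> \<epsilon> a) (signed \<phi> \<delta> b) (signed \<phi> \<gamma> t) = signed \<phi> \<gamma> (gyr a b t)"
    by (rule double_gyrator_exists[of gyr]) (rule that)
  then have "is_gyrator (Hp \<union> Hm) (double_op Hp f \<phi>) g"
    by (rule is_gyrator_double[OF H gyr])
  then show ?thesis
    unfolding gyrogroup_def using closed unit inverse e(1) by (meson UnI1)
qed

text \<open>For the forward direction, any gyrator of the union is compared with an explicit one,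
  and uniqueness in the doubled gyrogroup makes them agree on the carrier.\<close>

lemma is_gyrator_double_iff:
  assumes H: "gyrogroup Hp f" and gyr: "is_gyrator Hp f gyr"
  shows "is_gyrator (Hp \<union> Hm) (double_op Hp f \<phi>) g \<longleftrightarrow>
    (\<forall>a\<in>Hp. \<forall>b\<in>Hp. \<forall>t\<in>Hp. \<forall>\<epsilon> \<delta> \<gamma>.
      g (signed \<phi> \<epsilon> a) (signed \<phi> \<delta> b) (signed \<phi> \<gamma> t) = signed \<phi> \<gamma> (gyr a b t))"
    (is "?L \<longleftrightarrow> ?R")
proof
  assume ?L
  obtain g' where g': "\<And>a b t \<epsilon> \<delta> \<gamma>. a \<in> Hp \<Longrightarrow> b \<in> Hp \<Longrightarrow> t \<in> Hp \<Longrightarrow>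
      g' (signed \<phi> \<epsilon> a) (signed \<phi> \<delta> b) (signed \<phi> \<gamma> t) = signed \<phi> \<gamma> (gyr a b t)"
    by (rule double_gyrator_exists[of gyr]) (rule that)
  then have "is_gyrator (Hp \<union> Hm) (double_op Hp f \<phi>) g'"
    by (rule is_gyrator_double[OF H gyr])
  note eq = gyrator_unique[OF gyrogroup_double[OF H] \<open>?L\<close> this]
  show ?R
    \<comment> \<open>Membership in the union must stay unsplit for \<open>signed_closed\<close> to
      discharge the premises of \<open>eq\<close>.\<close>
    by (simp add: eq signed_closed g' del: Un_iff)
next
  assume ?R
  then show ?L
    by (intro is_gyrator_double[OF H gyr]) blast
qed

end

lemma signed_eq_case: "signed \<phi> \<gamma> h = (case \<gamma> of Plus \<Rightarrow> h | Minus \<Rightarrow> \<phi> h)"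
  by (cases \<gamma>) simp_all

theorem theorem2p1:
  fixes Hp Hm :: "'a set"
    and oplus :: "'a \<Rightarrow> 'a \<Rightarrow> 'a"
    and gyrH :: "'a \<Rightarrow> 'a \<Rightarrow> 'a \<Rightarrow> 'a"
    and \<phi> :: "'a \<Rightarrow> 'a"
  assumes "gyrogroup Hp oplus"
    and "is_gyrator Hp oplus gyrH"
    and "Hp \<inter> Hm = {}"
    and "bij_betw \<phi> Hp Hm"
  shows "gyrogroup (Hp \<union> Hm) (double_op Hp oplus \<phi>) \<and>
    (\<forall>gyrG. is_gyrator (Hp \<union> Hm) (double_op Hp oplus \<phi>) gyrG \<longleftrightarrow>
       (\<forall>a\<in>Hp. \<forall>b\<in>Hp. \<forall>t\<in>Hp. \<forall>\<epsilon> \<delta> \<gamma>.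
          gyrG (signed \<phi> \<epsilon> a) (signed \<phi> \<delta> b) (signed \<phi> \<gamma> t) =
            (case \<gamma> of Plus \<Rightarrow> gyrH a b t | Minus \<Rightarrow> \<phi> (gyrH a b t))))"
  using gyrogroup_double[OF assms(3,4,1)] is_gyrator_double_iff[OF assms(3,4,1,2)]
  by (simp only: signed_eq_case[symmetric] simp_thms)

end
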